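(* Let $N\ge 1$ be an integer and let $\mathcal{X}\subset\mathbb{R}/\mathbb{Z}$ be a finite set. Let $$\delta_\star=\min\biggl\{\Bigl\|\sum_{x\in\mathcal{A}}x-\sum_{x\in\mathcal{B}}x\Bigr\|_{\mathbb{R}/\mathbb{Z}}:\ \mathcal{A},\mathcal{B}\subset\mathcal{X},\ \mathcal{A}\neq\mathcal{B}\biggr\},$$ and assume that $\delta_\star>0$. Let $S\subset\{1,\ldots,N\}$ be nonempty and let $f$ be a complex-valued function with support inside $S$. Then $$\sum_{x\in\mathcal{X}}\biggl|\sum_{n\le N}f(n)e(nx)\biggr|^2\le 9\,|S|\,\|f\|_2^2\,\log\frac{8(N+\delta_\star^{-1})}{|S|}.$$ More generally, for any real number $\ell\ge1$, we have $$\biggl(\sum_{x\in\mathcal{X}}\biggl|\sum_{n\le N}f(n)e(nx)\biggr|^{\ell+1}\biggr)^2\le 9\,|S|\,\|f\|_2^2\,\sum_{x\in\mathcal{X}}\biggl|\sum_{n\le N}f(n)e(nx)\biggr|^{2\ell}\,\log\frac{8(N+\delta_\star^{-1})}{|S|}.$$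
   Context: Notation: $e(y)=\exp(2i\pi y)$; $\|f\|_2^2=\sum_n|f(n)|^2$; for $u\in\mathbb{R}/\mathbb{Z}$, $\|u\|_{\mathbb{R}/\mathbb{Z}}=\min_{k\in\mathbb{Z}}|u-k|$ is the distance to $0$ on the circle; $|S|$ is the cardinality of $S$. Sums over $n\le N$ are over positive integers $n$. *)

theory Defs
  imports "HOL-Analysis.Analysis"
begin

section \<open>The circle group R/Z\<close>

definition cong_ints :: "real \<Rightarrow> real \<Rightarrow> bool" where
  "cong_ints u v \<longleftrightarrow> u - v \<in> \<int>"

lemma equivp_cong_ints: "equivp cong_ints"
proof (rule equivpI)
  show "reflp cong_ints"
    by (simp add: reflp_def cong_ints_def)
  show "symp cong_ints"
    unfolding symp_def cong_ints_def by (metis Ints_minus minus_diff_eq)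
  show "transp cong_ints"
    unfolding transp_def cong_ints_def
    by (metis Ints_add diff_add_cancel add_diff_eq)
qed

quotient_type circle = real / cong_ints
  by (rule equivp_cong_ints)

instantiation circle :: ab_group_add
begin

lift_definition zero_circle :: circle is "0 :: real" .

lift_definition plus_circle :: "circle \<Rightarrow> circle \<Rightarrow> circle" is "(+)"
  unfolding cong_ints_def by (metis Ints_add add_diff_add)

lift_definition uminus_circle :: "circle \<Rightarrow> circle" is "uminus"
  unfolding cong_ints_def by (metis Ints_minus minus_diff_minus)

lift_definition minus_circle :: "circle \<Rightarrow> circle \<Rightarrow> circle" is "(-)"
proof -
  fix a b c d :: real
  assume "cong_ints a b" "cong_ints c d"
  then have "(a - b) - (c - d) \<in> \<int>"
    unfolding cong_ints_def by (rule Ints_diff)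
  then show "cong_ints (a - c) (b - d)"
    by (simp add: cong_ints_def algebra_simps)
qed

instance
  by standard (transfer; simp add: cong_ints_def)+

end

lift_definition circle_norm :: "circle \<Rightarrow> real" is
  "\<lambda>u. INF k::int. \<bar>u - of_int k\<bar>"
proof -
  fix u v :: real
  assume "cong_ints u v"
  then obtain m :: int where "u - v = of_int m"
    unfolding cong_ints_def by (rule Ints_cases)
  then have u: "u = v + of_int m" by simp
  have "range (\<lambda>k::int. \<bar>u - of_int k\<bar>) = (\<lambda>k::int. \<bar>v - of_int k\<bar>) ` range (\<lambda>k. k - m)"
    unfolding image_image u by (intro image_cong) auto
  also have "range (\<lambda>k. k - m) = UNIV"
    by (rule surjI[of _ "\<lambda>k. k + m"]) simp
  finally show "(INF k::int. \<bar>u - of_int k\<bar>) = (INF k::int. \<bar>v - of_int k\<bar>)"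
    by simp
qed

text \<open>The infimum defining \<^const>\<open>circle_norm\<close> is a minimum, attained at the nearest integer.\<close>

lemma circle_norm_abs_circle: "circle_norm (abs_circle u) = \<bar>u - of_int (round u)\<bar>"
proof -
  have "(INF k::int. \<bar>u - of_int k\<bar>) = \<bar>u - of_int (round u)\<bar>"
    by (rule cInf_eq_minimum) (use round_diff_minimal in auto)
  then show ?thesis by (simp add: circle_norm.abs_eq)
qed

lift_definition circle_scale :: "nat \<Rightarrow> circle \<Rightarrow> circle" is
  "\<lambda>n u. of_nat n * u"
  unfolding cong_ints_def by (metis Ints_mult Ints_of_nat right_diff_distrib)

lift_definition circle_exp :: "circle \<Rightarrow> complex" is
  "\<lambda>y. exp (2 * \<i> * of_real pi * of_real y)"
proof -
  fix u v :: real
  assume "cong_ints u v"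
  then obtain m :: int where "u - v = of_int m"
    unfolding cong_ints_def by (rule Ints_cases)
  then have u: "u = v + of_int m" by simp
  show "exp (2 * \<i> * of_real pi * of_real u) = exp (2 * \<i> * of_real pi * of_real v)"
    unfolding exp_eq by (rule exI[of _ m]) (simp add: u algebra_simps)
qed

section \<open>Subset sums, exponential sums and the L2 norm\<close>

text \<open>The value is an extended real so that the minimum over the empty family, which occurs
  exactly when \<open>X\<close> is empty, is \<open>\<infinity>\<close> (with inverse \<open>0\<close>). For finite nonempty \<open>X\<close> the infimum
  is a minimum of finitely many real numbers.\<close>

definition delta_star :: "circle set \<Rightarrow> ereal" where
  "delta_star X =
     Inf {ereal (circle_norm (\<Sum>A - \<Sum>B)) | A B. A \<subseteq> X \<and> B \<subseteq> X \<and> A \<noteq> B}"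

definition exp_sum :: "nat \<Rightarrow> (nat \<Rightarrow> complex) \<Rightarrow> circle \<Rightarrow> complex" where
  "exp_sum N f x = (\<Sum>n = 1..N. f n * circle_exp (circle_scale n x))"

definition l2_norm :: "(nat \<Rightarrow> complex) \<Rightarrow> real" where
  "l2_norm f = sqrt (\<Sum>\<^sub>\<infinity>n. (cmod (f n))\<^sup>2)"

lemma delta_star_empty: "delta_star {} = \<infinity>"
  by (simp add: delta_star_def top_ereal_def)

lemma delta_star_eq_Min:
  assumes "finite X" "X \<noteq> {}"
  shows "delta_star X =
    ereal (Min {circle_norm (\<Sum>A - \<Sum>B) | A B. A \<subseteq> X \<and> B \<subseteq> X \<and> A \<noteq> B})"
proof -
  define D where "D = {circle_norm (\<Sum>A - \<Sum>B) | A B. A \<subseteq> X \<and> B \<subseteq> X \<and> A \<noteq> B}"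
  have "D \<subseteq> (\<lambda>(A, B). circle_norm (\<Sum>A - \<Sum>B)) ` (Pow X \<times> Pow X)"
    unfolding D_def by auto
  then have fin: "finite D"
    by (rule finite_subset) (use assms in simp)
  have ne: "D \<noteq> {}"
    unfolding D_def using assms(2) by blast
  have "delta_star X = Inf (ereal ` D)"
    unfolding delta_star_def D_def by (rule arg_cong[where f = Inf]) blast
  also have "\<dots> = ereal (Min D)"
    by (rule Inf_eqI) (use fin ne in auto)
  finally show ?thesis by (simp add: D_def)
qed

end

theory Submission
  imports Defs
begin

text \<open>By duality and the Cauchy--Schwarz inequality it suffices to bound the mean square over
  \<open>S\<close> of \<open>G(n) = \<Sum>x\<in>X. a\<^sub>x e(nx)\<close>. For a unit complex number \<open>w\<close> one has
  \<open>exp (Re (a w)) \<le> \<bar>cosh (\<bar>a\<bar>/2) + sinh (\<bar>a\<bar>/2) (a/\<bar>a\<bar>) w\<bar>\<^sup>2\<close>, so \<open>exp (Re G(n))\<close> is at most the squared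
  modulus of a Riesz product. Its frequencies are the subset sums of \<open>X\<close>, which are
  \<open>\<delta>\<close>-spaced by hypothesis, so the large sieve gives
  \<open>\<Sum>n\<le>N. exp (Re G(n)) \<le> 5 (N + 1/\<delta>) exp ((\<Sum>x. \<bar>a\<^sub>x\<bar>\<^sup>2) / 2)\<close>. These exponential moments yield the mean
  square bound; the constant 9 leaves room for a large sieve with the non-optimal constant 5.\<close>

section \<open>Elementary inequalities for cosh and sin\<close>

lemma cosh_le_exp_half_square: "cosh t \<le> exp (t\<^sup>2 / 2)" for t :: real
proof -
  have *: "cosh t \<le> exp (t\<^sup>2 / 2)" if "t \<ge> 0" for t :: real
  proof -
    \<comment> \<open>That is, \<open>tanh s \<le> s\<close>: the difference
      \<open>s * cosh s - sinh s\<close> vanishes at 0 and has derivative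
      \<open>s * sinh s\<close>.\<close>
    have tanh: "sinh s \<le> s * cosh s" if "s \<ge> 0" for s :: real
    proof -
      have "0 * cosh 0 - sinh 0 \<le> s * cosh s - sinh s"
      proof (rule DERIV_nonneg_imp_nondecreasing[OF that])
        fix x :: real assume "0 \<le> x" "x \<le> s"
        then show "\<exists>y. ((\<lambda>x. x * cosh x - sinh x) has_real_derivative y) (at x) \<and> 0 \<le> y"
          by (intro exI[of _ "x * sinh x"] conjI) (auto intro!: derivative_eq_intros)
      qed
      then show ?thesis by simp
    qed
    \<comment> \<open>The derivative of the left side as a function of \<open>t\<close> is a
      positive factor times \<open>sinh x - x * cosh x\<close>, nonpositive by \<open>tanh\<close>,
      so the product never exceeds its value 1 at 0.\<close>
    have "exp (- (t\<^sup>2 / 2)) * cosh t \<le> exp (- (0\<^sup>2 / 2)) * cosh 0"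
    proof (rule DERIV_nonpos_imp_nonincreasing[OF that])
      fix x :: real assume "0 \<le> x" "x \<le> t"
      then show "\<exists>y. ((\<lambda>x. exp (- (x\<^sup>2 / 2)) * cosh x) has_real_derivative y) (at x) \<and> y \<le> 0"
        using tanh[of x]
        by (intro exI[of _ "exp (- (x\<^sup>2 / 2)) * (sinh x - x * cosh x)"] conjI)
           (auto intro!: derivative_eq_intros mult_nonneg_nonpos simp: algebra_simps)
    qed
    then show ?thesis by (simp add: exp_minus field_simps)
  qed
  show ?thesis using *[of "\<bar>t\<bar>"] by simp
qed

text \<open>Jordan's inequality: a concave function lies above its chord, here the one from 0 to
  \<open>pi / 2\<close>.\<close>

lemma sin_ge_two_over_pi:
  assumes "0 \<le> x" "x \<le> pi / 2"
  shows "2 / pi * x \<le> sin x"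
proof -
  have "concave_on {0..pi/2} sin"
    by (rule f''_le0_imp_concave[where f' = cos and f'' = "\<lambda>x. - sin x"])
       (auto intro!: derivative_eq_intros sin_ge_zero)
  from concave_onD[OF this, of "2 / pi * x" 0 "pi / 2"] assms show ?thesis
    by (simp add: field_simps)
qed

section \<open>Characters of the circle and geometric sums\<close>

lemma circle_exp_0 [simp]: "circle_exp 0 = 1"
  by transfer simp

lemma circle_exp_add: "circle_exp (x + y) = circle_exp x * circle_exp y"
  by transfer (simp add: exp_add algebra_simps)

lemma circle_exp_sum: "circle_exp (\<Sum>i\<in>A. g i) = (\<Prod>i\<in>A. circle_exp (g i))"
  by (induction A rule: infinite_finite_induct) (auto simp: circle_exp_add)

lemma norm_circle_exp [simp]: "cmod (circle_exp x) = 1"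
  by transfer (simp add: norm_exp_eq_Re)

lemma circle_exp_diff: "circle_exp (x - y) = circle_exp x * cnj (circle_exp y)"
  by transfer (simp add: exp_diff exp_cnj field_simps flip: exp_add)

lemma circle_exp_scale: "circle_exp (circle_scale n x) = circle_exp x ^ n"
  by transfer (simp add: algebra_simps flip: exp_of_nat_mult)

lemma circle_norm_triangle_real:
  "circle_norm (abs_circle u - abs_circle v) \<le> \<bar>(u - of_int (round u)) - (v - of_int (round v))\<bar>"
proof -
  have "circle_norm (abs_circle u - abs_circle v) = circle_norm (abs_circle (u - v))"
    by (simp add: minus_circle.abs_eq)
  also have "\<dots> \<le> \<bar>(u - v) - of_int (round u - round v)\<bar>"
    unfolding circle_norm_abs_circle by (rule round_diff_minimal)
  finally show ?thesis by (simp add: algebra_simps)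
qed

text \<open>For the representative \<open>r\<close> with \<open>\<bar>r\<bar> \<le> 1 / 2\<close>
  the chord from 1 to e(r) has length \<open>2 * \<bar>sin (pi * r)\<bar>\<close>, and Jordan's
  inequality bounds this below linearly.\<close>

lemma norm_one_minus_circle_exp: "4 * circle_norm x \<le> cmod (1 - circle_exp x)"
proof -
  obtain u where x: "x = abs_circle u"
    by (metis Quotient_circle Quotient_def)
  define r where "r = u - of_int (round u)"
  have r: "\<bar>r\<bar> \<le> 1 / 2"
    unfolding r_def by (metis abs_minus_commute of_int_round_abs_le)
  have xr: "x = abs_circle r"
    unfolding x circle.abs_eq_iff cong_ints_def r_def by simp
  have "2 / pi * (pi * \<bar>r\<bar>) \<le> sin (pi * \<bar>r\<bar>)"
    by (rule sin_ge_two_over_pi) (use r in auto)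
  also have "sin (pi * \<bar>r\<bar>) \<le> \<bar>sin (pi * r)\<bar>"
    by (cases "r \<ge> 0") auto
  finally have "2 * \<bar>r\<bar> \<le> \<bar>sin (pi * r)\<bar>" by simp
  moreover have "cmod (1 - circle_exp x) = 2 * \<bar>sin (pi * r)\<bar>"
    using dist_exp_i_1[of "2 * pi * r"]
    by (simp add: xr circle_exp.abs_eq norm_minus_commute mult_ac)
  moreover have "circle_norm x = \<bar>r\<bar>"
    by (simp add: x circle_norm_abs_circle r_def)
  ultimately show ?thesis by simp
qed

lemma norm_geometric_sum_le:
  assumes "circle_norm x > 0"
  shows "cmod (\<Sum>a<K. circle_exp x ^ a) \<le> 1 / (2 * circle_norm x)"
proof -
  let ?w = "circle_exp x"
  have *: "4 * circle_norm x \<le> cmod (1 - ?w)" by (rule norm_one_minus_circle_exp)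
  with assms have "?w \<noteq> 1" by auto
  then have "cmod (\<Sum>a<K. ?w ^ a) = cmod (1 - ?w ^ K) / cmod (1 - ?w)"
    by (simp add: sum_gp_strict norm_divide)
  also have "\<dots> \<le> 2 / (4 * circle_norm x)"
  proof (rule frac_le)
    show "cmod (1 - ?w ^ K) \<le> 2"
      using norm_triangle_ineq4[of 1 "?w ^ K"] by (simp add: norm_power)
  qed (use * assms in auto)
  finally show ?thesis by simp
qed

lemma norm_geometric_sum_le_length: "cmod (\<Sum>a<K. circle_exp x ^ a) \<le> real K"
  using norm_sum[of "\<lambda>a. circle_exp x ^ a" "{..<K}"] by (simp add: norm_power)

section \<open>The large sieve for spaced points\<close>

lemma sum_inverse_squares_le: "(\<Sum>k=1..n. 1 / (real k)\<^sup>2) \<le> 2"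
proof -
  \<comment> \<open>The sharper bound makes the induction close, by telescoping 1/(n(n+1)).\<close>
  have "(\<Sum>k=1..n. 1 / (real k)\<^sup>2) \<le> 2 - 1 / real n" if "n \<ge> 1" for n
    using that
  proof (induction n rule: dec_induct)
    case (step n)
    have "1 / (real n + 1)\<^sup>2 \<le> 1 / (real n * (real n + 1))"
      using step(1) by (intro divide_left_mono) (auto simp: power2_eq_square)
    also have "\<dots> = 1 / real n - 1 / (real n + 1)"
      using step(1) by (simp add: field_simps)
    finally show ?case using step by (simp add: add_ac)
  qed simp
  from this[of n] show ?thesis
    by (cases "n = 0") (auto intro: order_trans)
qed

text \<open>Cut the half line into cells of length \<open>d\<close>. Spacing allows at most one
  point per cell; the point in cell 0 contributes at most \<open>A\<close>, the one in cell
  \<open>k \<ge> 1\<close> at most B/(kd)^2, and the inverse squares sum to at most 2.\<close>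

lemma sum_spaced_le:
  fixes g F :: "'a \<Rightarrow> real"
  assumes "finite P" "d > 0" "A \<ge> 0" "B \<ge> 0"
    and g: "\<And>i. i \<in> P \<Longrightarrow> g i \<ge> 0"
    and spaced: "\<And>i j. i \<in> P \<Longrightarrow> j \<in> P \<Longrightarrow> i \<noteq> j \<Longrightarrow> d \<le> \<bar>g i - g j\<bar>"
    and FA: "\<And>i. i \<in> P \<Longrightarrow> F i \<le> A"
    and FB: "\<And>i. i \<in> P \<Longrightarrow> g i > 0 \<Longrightarrow> F i \<le> B / (g i)\<^sup>2"
  shows "(\<Sum>i\<in>P. F i) \<le> A + 2 * B / d\<^sup>2"
proof -
  define h where "h i = nat \<lfloor>g i / d\<rfloor>" for i
  define H where "H k = (if k = 0 then A else B / d\<^sup>2 * (1 / (real k)\<^sup>2))" for k :: nat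
  have h: "real (h i) \<le> g i / d" "g i / d < real (h i) + 1" if "i \<in> P" for i
    using g[OF that] assms(2) unfolding h_def by (auto simp: of_nat_nat)
  have inj: "inj_on h P"
  proof (rule inj_onI, rule ccontr)
    fix i j assume ij: "i \<in> P" "j \<in> P" "h i = h j" "i \<noteq> j"
    then have "\<bar>g i / d - g j / d\<bar> < 1"
      using h[of i] h[of j] by linarith
    then have "\<bar>g i - g j\<bar> < d"
      using assms(2) by (simp flip: diff_divide_distrib add: abs_divide field_simps)
    with spaced ij show False by fastforce
  qed
  have FH: "F i \<le> H (h i)" if i: "i \<in> P" for i
  proof (cases "h i = 0")
    case False
    have *: "real (h i) * d \<le> g i"
      using h[OF i] assms(2) by (simp add: field_simps)
    have pos: "0 < real (h i) * d" using False assms(2) by simp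
    have "F i \<le> B / (g i)\<^sup>2" using FB[OF i] * pos by linarith
    also have "\<dots> \<le> B / (real (h i) * d)\<^sup>2"
    proof (rule divide_left_mono)
      show "0 < (g i)\<^sup>2 * (real (h i) * d)\<^sup>2"
        by (intro mult_pos_pos[OF zero_less_power zero_less_power]) (use * pos in linarith)+
    qed (use * pos assms(4) in \<open>auto intro: power_mono\<close>)
    finally show ?thesis using False by (simp add: H_def power_mult_distrib mult_ac)
  qed (use FA i in \<open>auto simp: H_def\<close>)
  define n where "n = (\<Sum>i\<in>P. h i)"
  have sub: "h ` P \<subseteq> {0..n}"
    unfolding n_def using assms(1) by (auto intro: member_le_sum)
  have "(\<Sum>i\<in>P. F i) \<le> (\<Sum>i\<in>P. H (h i))" by (rule sum_mono) (rule FH)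
  also have "\<dots> = (\<Sum>k\<in>h ` P. H k)" using inj by (simp add: sum.reindex)
  also have "\<dots> \<le> (\<Sum>k=0..n. H k)"
    using sub assms by (intro sum_mono2) (auto simp: H_def)
  also have "\<dots> = A + B / d\<^sup>2 * (\<Sum>k=1..n. 1 / (real k)\<^sup>2)"
    by (simp add: sum.atLeast_Suc_atMost H_def sum_distrib_left)
  also have "\<dots> \<le> A + B / d\<^sup>2 * 2"
    using sum_inverse_squares_le[of n] assms by (intro add_mono mult_left_mono) auto
  finally show ?thesis by (simp add: mult.commute)
qed

text \<open>Schur's test: split \<open>x i * x j\<close> by the arithmetic-geometric mean
  inequality; by symmetry of \<open>\<kappa>\<close> both halves reduce to row sums.\<close>

lemma schur_test:
  fixes \<kappa> :: "'a \<Rightarrow> 'a \<Rightarrow> real"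
  assumes "\<And>i j. \<kappa> i j \<ge> 0" "\<And>i j. \<kappa> i j = \<kappa> j i"
    and "\<And>i. i \<in> I \<Longrightarrow> (\<Sum>j\<in>I. \<kappa> i j) \<le> R"
  shows "(\<Sum>i\<in>I. \<Sum>j\<in>I. x i * x j * \<kappa> i j) \<le> R * (\<Sum>i\<in>I. (x i)\<^sup>2)"
proof -
  have "(\<Sum>i\<in>I. \<Sum>j\<in>I. x i * x j * \<kappa> i j) \<le> (\<Sum>i\<in>I. \<Sum>j\<in>I. ((x i)\<^sup>2 / 2 + (x j)\<^sup>2 / 2) * \<kappa> i j)"
  proof (intro sum_mono mult_right_mono assms)
    fix i j
    show "x i * x j \<le> (x i)\<^sup>2 / 2 + (x j)\<^sup>2 / 2"
      using sum_squares_bound[of "x i" "x j"] by simp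
  qed
  also have "\<dots> = (\<Sum>i\<in>I. \<Sum>j\<in>I. (x i)\<^sup>2 / 2 * \<kappa> i j) + (\<Sum>i\<in>I. \<Sum>j\<in>I. (x j)\<^sup>2 / 2 * \<kappa> i j)"
    by (simp add: distrib_right sum.distrib)
  also have "(\<Sum>i\<in>I. \<Sum>j\<in>I. (x j)\<^sup>2 / 2 * \<kappa> i j) = (\<Sum>i\<in>I. \<Sum>j\<in>I. (x i)\<^sup>2 / 2 * \<kappa> i j)"
    by (subst sum.swap) (simp add: assms(2))
  also have "(\<Sum>i\<in>I. \<Sum>j\<in>I. (x i)\<^sup>2 / 2 * \<kappa> i j) + \<dots> = (\<Sum>i\<in>I. (x i)\<^sup>2 * (\<Sum>j\<in>I. \<kappa> i j))"
    by (simp add: sum_distrib_left sum_distrib_right mult_ac flip: sum.distrib)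
  also have "\<dots> \<le> (\<Sum>i\<in>I. (x i)\<^sup>2 * R)"
    by (intro sum_mono mult_left_mono assms) auto
  finally show ?thesis by (simp add: sum_distrib_left mult_ac)
qed

text \<open>A single Dirichlet kernel decays only like 1/r and would cost a logarithm. The product
  of two decays like 1/(4r^2), which is summable over spaced points.\<close>

lemma dirichlet_row_sum_le:
  fixes \<xi> :: "'a \<Rightarrow> circle"
  assumes "finite I" "d > 0" "i \<in> I"
    and spaced: "\<And>i j. i \<in> I \<Longrightarrow> j \<in> I \<Longrightarrow> i \<noteq> j \<Longrightarrow> d \<le> circle_norm (\<xi> i - \<xi> j)"
  shows "(\<Sum>j\<in>I. cmod (\<Sum>a<K. circle_exp (\<xi> i - \<xi> j) ^ a) * cmod (\<Sum>b<L. circle_exp (\<xi> i - \<xi> j) ^ b))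
           \<le> 2 * real K * real L + 1 / d\<^sup>2"
proof -
  define F where "F j = cmod (\<Sum>a<K. circle_exp (\<xi> i - \<xi> j) ^ a) * cmod (\<Sum>b<L. circle_exp (\<xi> i - \<xi> j) ^ b)" for j
  have "\<exists>u. \<xi> i - \<xi> j = abs_circle u" for j
    by (metis Quotient_circle Quotient_def)
  then obtain u where u: "\<And>j. \<xi> i - \<xi> j = abs_circle (u j)" by metis
  define r where "r j = u j - of_int (round (u j))" for j
  have norm: "circle_norm (\<xi> i - \<xi> j) = \<bar>r j\<bar>" for j
    by (simp add: u circle_norm_abs_circle r_def)
  have rr: "d \<le> \<bar>r j - r k\<bar>" if "j \<in> I" "k \<in> I" "j \<noteq> k" for j k
  proof -
    have "d \<le> circle_norm (\<xi> k - \<xi> j)" using spaced that by blast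
    also have "\<xi> k - \<xi> j = (\<xi> i - \<xi> j) - (\<xi> i - \<xi> k)" by simp
    also have "circle_norm \<dots> \<le> \<bar>r j - r k\<bar>"
      unfolding u r_def by (rule circle_norm_triangle_real)
    finally show ?thesis .
  qed
  have FA: "F j \<le> real K * real L" for j
    unfolding F_def by (intro mult_mono norm_geometric_sum_le_length) auto
  have FB: "F j \<le> (1 / 4) / \<bar>r j\<bar>\<^sup>2" if "\<bar>r j\<bar> > 0" for j
  proof -
    have "F j \<le> (1 / (2 * \<bar>r j\<bar>)) * (1 / (2 * \<bar>r j\<bar>))"
      unfolding F_def norm[symmetric]
      by (intro mult_mono norm_geometric_sum_le) (use that in \<open>auto simp: norm\<close>)
    then show ?thesis by (simp add: power2_eq_square)
  qed
  \<comment> \<open>Points on opposite sides of 0 may have close absolute values, so the two signs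
    of \<open>r j\<close> are summed separately.\<close>
  have half: "(\<Sum>j\<in>P. F j) \<le> real K * real L + 2 * (1 / 4) / d\<^sup>2"
    if "P = {j\<in>I. r j \<ge> 0} \<or> P = {j\<in>I. r j < 0}" for P
  proof (rule sum_spaced_le[where g = "\<lambda>j. \<bar>r j\<bar>"])
    fix j k assume "j \<in> P" "k \<in> P" "j \<noteq> k"
    with that rr[of j k] show "d \<le> \<bar>\<bar>r j\<bar> - \<bar>r k\<bar>\<bar>" by auto
  qed (use that assms FA FB in auto)
  have "(\<Sum>j\<in>I. F j) = (\<Sum>j\<in>{j\<in>I. r j \<ge> 0} \<union> {j\<in>I. r j < 0}. F j)"
    by (rule sum.cong) auto
  also have "\<dots> = (\<Sum>j\<in>{j\<in>I. r j \<ge> 0}. F j) + (\<Sum>j\<in>{j\<in>I. r j < 0}. F j)"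
    using assms(1) by (intro sum.union_disjoint) auto
  also have "\<dots> \<le> (real K * real L + 2 * (1 / 4) / d\<^sup>2) + (real K * real L + 2 * (1 / 4) / d\<^sup>2)"
    by (intro add_mono half) auto
  finally show ?thesis by (simp add: F_def)
qed

text \<open>Each \<open>n\<close> is averaged over its representations as a difference
  \<open>a - b\<close>. Opening the square then produces a product of two geometric sums as kernel,
  to which Schur's test applies.\<close>

lemma large_sieve:
  fixes \<xi> :: "'a \<Rightarrow> circle" and c :: "'a \<Rightarrow> complex"
  assumes "finite I" "d > 0" "N \<ge> 1"
    and spaced: "\<And>i j. i \<in> I \<Longrightarrow> j \<in> I \<Longrightarrow> i \<noteq> j \<Longrightarrow> d \<le> circle_norm (\<xi> i - \<xi> j)"
  shows "(\<Sum>n=1..N. (cmod (\<Sum>i\<in>I. c i * circle_exp (\<xi> i) ^ n))\<^sup>2)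
           \<le> 5 * (real N + 1 / d) * (\<Sum>i\<in>I. (cmod (c i))\<^sup>2)"
proof -
  \<comment> \<open>\<open>M\<close> dominates both \<open>N\<close> and \<open>1 / d\<close>, yet
    stays at most \<open>N + 1 / d\<close>: the ceiling costs less than 1, which
    \<open>N \<ge> 1\<close> pays for.\<close>
  define M where "M = max N (nat \<lceil>1 / d\<rceil>)"
  have M: "N \<le> M" "M \<ge> 1" "1 / d \<le> real M"
    using assms(3) by (auto simp: M_def) linarith
  have M_le: "real M \<le> real N + 1 / d"
    using assms(2,3) by (auto simp: M_def max_def not_le of_nat_nat) linarith
  define H where "H a b = (\<Sum>i\<in>I. c i * circle_exp (\<xi> i) ^ a * cnj (circle_exp (\<xi> i)) ^ b)" for a b
  define w where "w i j = circle_exp (\<xi> i - \<xi> j)" for i j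
  define \<kappa> where "\<kappa> i j = cmod (\<Sum>a<2*M. w i j ^ a) * cmod (\<Sum>b<M. w i j ^ b)" for i j
  have unit: "circle_exp x * cnj (circle_exp x) = 1" for x
    by (simp flip: complex_norm_square)
  have w_sym: "w j i = cnj (w i j)" for i j
    by (simp add: w_def circle_exp_diff)
  have H_diag: "H (n + b) b = (\<Sum>i\<in>I. c i * circle_exp (\<xi> i) ^ n)" for n b
    unfolding H_def
  proof (rule sum.cong[OF refl])
    fix i
    have "c i * circle_exp (\<xi> i) ^ (n + b) * cnj (circle_exp (\<xi> i)) ^ b
        = c i * circle_exp (\<xi> i) ^ n * (circle_exp (\<xi> i) * cnj (circle_exp (\<xi> i))) ^ b"
      by (simp add: power_add power_mult_distrib mult_ac)
    then show "c i * circle_exp (\<xi> i) ^ (n + b) * cnj (circle_exp (\<xi> i)) ^ b = c i * circle_exp (\<xi> i) ^ n"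
      by (simp add: unit)
  qed
  \<comment> \<open>every \<open>n \<le> N\<close> has exactly \<open>M\<close> representations \<open>n = a - b\<close> with \<open>a < 2M\<close> and \<open>b < M\<close>\<close>
  have "real M * (\<Sum>n=1..N. (cmod (\<Sum>i\<in>I. c i * circle_exp (\<xi> i) ^ n))\<^sup>2)
      = (\<Sum>b<M. \<Sum>n=1..N. (cmod (H (n + b) b))\<^sup>2)"
    by (simp add: H_diag)
  \<comment> \<open>Since \<open>n \<le> M\<close> and \<open>b < M\<close>, the index
    \<open>n + b\<close> stays below \<open>2 * M\<close>; the added terms are nonnegative. The full
    rectangle is what lets the kernel factor.\<close>
  also have "\<dots> \<le> (\<Sum>b<M. \<Sum>a<2*M. (cmod (H a b))\<^sup>2)"
  proof (rule sum_mono)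
    fix b assume "b \<in> {..<M}"
    then have sub: "(\<lambda>n. n + b) ` {1..N} \<subseteq> {..<2*M}" using M by auto
    have "(\<Sum>n=1..N. (cmod (H (n + b) b))\<^sup>2) = (\<Sum>a\<in>(\<lambda>n. n + b) ` {1..N}. (cmod (H a b))\<^sup>2)"
      by (subst sum.reindex) (auto simp: o_def)
    also have "\<dots> \<le> (\<Sum>a<2*M. (cmod (H a b))\<^sup>2)"
      using sub by (intro sum_mono2) auto
    finally show "(\<Sum>n=1..N. (cmod (H (n + b) b))\<^sup>2) \<le> (\<Sum>a<2*M. (cmod (H a b))\<^sup>2)" .
  qed
  also have "\<dots> \<le> (\<Sum>i\<in>I. \<Sum>j\<in>I. cmod (c i) * cmod (c j) * \<kappa> i j)"
  proof -
    have sq: "complex_of_real ((cmod (H a b))\<^sup>2)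
        = (\<Sum>i\<in>I. \<Sum>j\<in>I. c i * cnj (c j) * (w i j ^ a * cnj (w i j) ^ b))" for a b
      unfolding complex_norm_square H_def
      by (simp add: sum_product w_def circle_exp_diff power_mult_distrib mult_ac)
    have "complex_of_real (\<Sum>b<M. \<Sum>a<2*M. (cmod (H a b))\<^sup>2)
        = (\<Sum>b<M. \<Sum>a<2*M. \<Sum>i\<in>I. \<Sum>j\<in>I. c i * cnj (c j) * (w i j ^ a * cnj (w i j) ^ b))"
      by (simp add: sq del: of_real_power)
    also have "\<dots> = (\<Sum>b<M. \<Sum>i\<in>I. \<Sum>j\<in>I. \<Sum>a<2*M. c i * cnj (c j) * (w i j ^ a * cnj (w i j) ^ b))"
      by (simp only: sum.swap[of _ _ "{..<2*M}"])
    also have "\<dots> = (\<Sum>i\<in>I. \<Sum>j\<in>I. \<Sum>a<2*M. \<Sum>b<M. c i * cnj (c j) * (w i j ^ a * cnj (w i j) ^ b))"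
      by (simp only: sum.swap[of _ _ "{..<M}"])
    also have "\<dots> = (\<Sum>i\<in>I. \<Sum>j\<in>I. c i * cnj (c j) * ((\<Sum>a<2*M. w i j ^ a) * cnj (\<Sum>b<M. w i j ^ b)))"
      by (simp add: sum_product sum_distrib_left mult_ac)
    finally have eq: "complex_of_real (\<Sum>b<M. \<Sum>a<2*M. (cmod (H a b))\<^sup>2) = \<dots>" .
    have "(\<Sum>b<M. \<Sum>a<2*M. (cmod (H a b))\<^sup>2) = cmod (complex_of_real (\<Sum>b<M. \<Sum>a<2*M. (cmod (H a b))\<^sup>2))"
      by (simp only: norm_of_real) (simp add: sum_nonneg)
    also have "\<dots> \<le> (\<Sum>i\<in>I. \<Sum>j\<in>I. cmod (c i * cnj (c j) * ((\<Sum>a<2*M. w i j ^ a) * cnj (\<Sum>b<M. w i j ^ b))))"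
      unfolding eq by (intro order.trans[OF norm_sum] sum_mono norm_sum)
    also have "\<dots> = (\<Sum>i\<in>I. \<Sum>j\<in>I. cmod (c i) * cmod (c j) * \<kappa> i j)"
      unfolding \<kappa>_def norm_mult complex_mod_cnj by (simp add: mult_ac)
    finally show ?thesis .
  qed
  also have "\<dots> \<le> (2 * real (2 * M) * real M + 1 / d\<^sup>2) * (\<Sum>i\<in>I. (cmod (c i))\<^sup>2)"
  proof (rule schur_test)
    show "\<kappa> i j = \<kappa> j i" for i j
      unfolding \<kappa>_def w_sym[of j i] by (simp flip: complex_cnj_power cnj_sum)
    show "(\<Sum>j\<in>I. \<kappa> i j) \<le> 2 * real (2 * M) * real M + 1 / d\<^sup>2" if "i \<in> I" for i
      unfolding \<kappa>_def w_def by (rule dirichlet_row_sum_le) (use that assms in auto)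
  qed (simp add: \<kappa>_def)
  \<comment> \<open>With \<open>1 / d \<le> M\<close>, the row bound 4M^2 + 1/d^2 is at most M(4M +
    1/d), hence \<open>M\<close> times 5(N + 1/d); the factor \<open>M\<close> cancels against the
    averaging.\<close>
  also have "\<dots> \<le> (real M * (5 * (real N + 1 / d))) * (\<Sum>i\<in>I. (cmod (c i))\<^sup>2)"
  proof (intro mult_right_mono sum_nonneg)
    have "1 / d\<^sup>2 = 1 / d * (1 / d)" by (simp add: power2_eq_square)
    also have "\<dots> \<le> real M * (1 / d)"
      using M assms(2) by (intro mult_right_mono) auto
    finally have "2 * real (2 * M) * real M + 1 / d\<^sup>2 \<le> real M * (4 * real M + 1 / d)"
      by (simp add: algebra_simps)
    also have "\<dots> \<le> real M * (5 * (real N + 1 / d))"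
      using M_le assms(2) by (intro mult_left_mono) auto
    finally show "2 * real (2 * M) * real M + 1 / d\<^sup>2 \<le> real M * (5 * (real N + 1 / d))" .
  qed auto
  finally show ?thesis using M(2) by (simp add: mult.assoc)
qed

section \<open>Riesz products and exponential moments\<close>

lemma exp_mult_le_cosh_sinh:
  fixes t u :: real
  assumes "\<bar>u\<bar> \<le> 1"
  shows "exp (t * u) \<le> cosh t + u * sinh t"
proof -
  \<comment> \<open>Convexity of exp: \<open>t * u\<close> is the average of \<open>- t\<close> and
    \<open>t\<close> with weight \<open>(1 + u) / 2\<close> on \<open>t\<close>.\<close>
  have "exp ((1 - (1 + u) / 2) *\<^sub>R (- t) + ((1 + u) / 2) *\<^sub>R t)
      \<le> (1 - (1 + u) / 2) * exp (- t) + (1 + u) / 2 * exp t"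
    by (rule convex_onD[OF exp_convex]) (use assms in auto)
  also have "(1 - (1 + u) / 2) *\<^sub>R (- t) + ((1 + u) / 2) *\<^sub>R t = t * u"
    by (simp add: field_simps)
  finally show ?thesis by (simp add: cosh_def sinh_def field_simps)
qed

text \<open>With \<open>t = cmod a\<close> and the unit number \<open>v = sgn a * w\<close>, the
  arguments \<open>t / 2\<close> make the square expand, by the double-argument formulas, to exactly
  \<open>cosh t + Re v * sinh t\<close>, the chord bound for \<open>exp (t * Re v)\<close>.\<close>

lemma exp_Re_le_norm_square:
  assumes "cmod w = 1"
  shows "exp (Re (a * w)) \<le> (cmod (of_real (sinh (cmod a / 2)) * sgn a * w + of_real (cosh (cmod a / 2))))\<^sup>2"
proof (cases "a = 0")
  case False
  define t v where "t = cmod a" and "v = sgn a * w"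
  have v: "cmod v = 1" using assms False by (simp add: v_def norm_mult norm_sgn)
  have av: "a * w = of_real t * v"
    using False by (simp add: v_def t_def sgn_eq)
  have "exp (Re (a * w)) \<le> cosh t + Re v * sinh t"
    using exp_mult_le_cosh_sinh[of "Re v" t] abs_Re_le_cmod[of v] v by (simp add: av)
  also have "\<dots> = (cosh (t/2))\<^sup>2 + (sinh (t/2))\<^sup>2 + 2 * sinh (t/2) * cosh (t/2) * Re v"
    using cosh_double[of "t/2"] sinh_double[of "t/2"] by simp
  also have "\<dots> = (cosh (t/2))\<^sup>2 + (sinh (t/2))\<^sup>2 * ((Re v)\<^sup>2 + (Im v)\<^sup>2) + 2 * sinh (t/2) * cosh (t/2) * Re v"
    using v by (simp add: cmod_power2[symmetric])
  also have "\<dots> = (cmod (of_real (sinh (t/2)) * v + of_real (cosh (t/2))))\<^sup>2"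
    unfolding cmod_power2 by (simp add: algebra_simps power2_eq_square)
  finally show ?thesis by (simp add: t_def v_def mult.assoc)
qed simp

lemma sum_exp_Re_le:
  fixes X :: "circle set" and a :: "circle \<Rightarrow> complex"
  assumes "finite X" "d > 0" "N \<ge> 1"
    and spaced: "\<And>A B. A \<subseteq> X \<Longrightarrow> B \<subseteq> X \<Longrightarrow> A \<noteq> B \<Longrightarrow> d \<le> circle_norm (\<Sum>A - \<Sum>B)"
  shows "(\<Sum>n=1..N. exp (Re (\<Sum>x\<in>X. a x * circle_exp x ^ n)))
           \<le> 5 * (real N + 1 / d) * exp ((\<Sum>x\<in>X. (cmod (a x))\<^sup>2) / 2)"
proof -
  define \<alpha> where "\<alpha> x = complex_of_real (cosh (cmod (a x) / 2))" for x
  define \<beta> where "\<beta> x = of_real (sinh (cmod (a x) / 2)) * sgn (a x)" for x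
  \<comment> \<open>Coefficient of the frequency \<open>\<Sum>A\<close> when the product of the
    factors \<open>\<beta> x * circle_exp x ^ n + \<alpha> x\<close> is multiplied out.\<close>
  define c where "c A = (\<Prod>x\<in>A. \<beta> x) * (\<Prod>x\<in>X - A. \<alpha> x)" for A
  have "exp (Re (\<Sum>x\<in>X. a x * circle_exp x ^ n))
      \<le> (cmod (\<Sum>A\<in>Pow X. c A * circle_exp (\<Sum>A) ^ n))\<^sup>2" for n
  proof -
    have "exp (Re (\<Sum>x\<in>X. a x * circle_exp x ^ n)) = (\<Prod>x\<in>X. exp (Re (a x * circle_exp x ^ n)))"
      using assms(1) by (simp add: exp_sum)
    also have "\<dots> \<le> (\<Prod>x\<in>X. (cmod (\<beta> x * circle_exp x ^ n + \<alpha> x))\<^sup>2)"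
      unfolding \<alpha>_def \<beta>_def
      by (intro prod_mono conjI exp_Re_le_norm_square) (auto simp: norm_power)
    also have "\<dots> = (cmod (\<Prod>x\<in>X. \<beta> x * circle_exp x ^ n + \<alpha> x))\<^sup>2"
      unfolding prod_norm[symmetric] prod_power_distrib ..
    also have "(\<Prod>x\<in>X. \<beta> x * circle_exp x ^ n + \<alpha> x) = (\<Sum>A\<in>Pow X. c A * circle_exp (\<Sum>A) ^ n)"
      unfolding prod_add[OF assms(1)] c_def circle_exp_sum
      by (simp add: prod.distrib prod_power_distrib mult_ac)
    finally show ?thesis .
  qed
  then have "(\<Sum>n=1..N. exp (Re (\<Sum>x\<in>X. a x * circle_exp x ^ n)))
      \<le> (\<Sum>n=1..N. (cmod (\<Sum>A\<in>Pow X. c A * circle_exp (\<Sum>A) ^ n))\<^sup>2)"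
    by (intro sum_mono)
  also have "\<dots> \<le> 5 * (real N + 1 / d) * (\<Sum>A\<in>Pow X. (cmod (c A))\<^sup>2)"
    by (rule large_sieve) (use assms in auto)
  \<comment> \<open>The squared coefficients are again products over \<open>A\<close> and its
    complement, so their sum refolds into a product, with factors at most
    \<open>cosh (cmod (a x))\<close>.\<close>
  also have "(\<Sum>A\<in>Pow X. (cmod (c A))\<^sup>2) = (\<Prod>x\<in>X. (cmod (\<beta> x))\<^sup>2 + (cmod (\<alpha> x))\<^sup>2)"
    unfolding prod_add[OF assms(1)] c_def
    by (simp add: norm_mult power_mult_distrib prod_power_distrib flip: prod_norm)
  also have "\<dots> \<le> (\<Prod>x\<in>X. exp ((cmod (a x))\<^sup>2 / 2))"
  proof (intro prod_mono conjI)
    fix x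
    have "(cmod (\<beta> x))\<^sup>2 + (cmod (\<alpha> x))\<^sup>2 \<le> (sinh (cmod (a x) / 2))\<^sup>2 + (cosh (cmod (a x) / 2))\<^sup>2"
      by (auto simp: \<beta>_def \<alpha>_def norm_mult norm_sgn)
    also have "\<dots> = cosh (cmod (a x))"
      using cosh_double[of "cmod (a x) / 2"] by simp
    also have "\<dots> \<le> exp ((cmod (a x))\<^sup>2 / 2)" by (rule cosh_le_exp_half_square)
    finally show "(cmod (\<beta> x))\<^sup>2 + (cmod (\<alpha> x))\<^sup>2 \<le> exp ((cmod (a x))\<^sup>2 / 2)" .
  qed auto
  also have "\<dots> = exp ((\<Sum>x\<in>X. (cmod (a x))\<^sup>2) / 2)"
    using assms(1) by (simp add: exp_sum sum_divide_distrib)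
  finally show ?thesis using assms(2) by (simp add: mult_left_mono)
qed

section \<open>From exponential moments to mean squares\<close>

text \<open>Only the excess \<open>y\<close> of \<open>\<bar>x\<bar>\<close> over the threshold
  \<open>\<tau>\<close> must be paid for exponentially: \<open>\<tau> \<ge> 1\<close> gives
  \<open>y \<le> \<tau> * y\<close>, and the quadratic Taylor bound for exp does the rest.\<close>

lemma square_le_exp:
  fixes \<tau> x :: real
  assumes "\<tau> \<ge> 1"
  shows "x\<^sup>2 \<le> \<tau>\<^sup>2 + 2 * exp (\<tau> * \<bar>x\<bar> - \<tau>\<^sup>2)"
proof (cases "\<bar>x\<bar> \<le> \<tau>")
  case True
  then have "x\<^sup>2 \<le> \<tau>\<^sup>2" using assms abs_le_square_iff[of x \<tau>] by simp
  then show ?thesis by (simp add: add_increasing2)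
next
  case False
  define y where "y = \<bar>x\<bar> - \<tau>"
  have y: "y \<ge> 0" using False by (simp add: y_def)
  have "x\<^sup>2 = (\<tau> + y)\<^sup>2" by (simp add: y_def)
  also have "\<dots> = \<tau>\<^sup>2 + 2 * (\<tau> * y + y\<^sup>2 / 2)"
    by (simp add: power2_eq_square algebra_simps)
  also have "y\<^sup>2 \<le> (\<tau> * y)\<^sup>2"
    using assms y by (intro power_mono) (auto simp: mult_le_cancel_right1)
  also have "\<tau> * y + (\<tau> * y)\<^sup>2 / 2 \<le> exp (\<tau> * y)"
    using exp_lower_Taylor_quadratic[of "\<tau> * y"] assms y by simp
  also have "\<tau> * y = \<tau> * \<bar>x\<bar> - \<tau>\<^sup>2" by (simp add: y_def algebra_simps power2_eq_square)
  finally show ?thesis by simp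
qed

lemma sum_square_le_of_sum_exp_le:
  fixes u :: "'a \<Rightarrow> real"
  assumes "finite S" "K \<ge> 1"
    and "\<And>\<tau>. (\<Sum>n\<in>S. exp (\<tau> * u n)) \<le> 5 * K * real (card S) * exp (\<tau>\<^sup>2 / 2)"
  shows "(\<Sum>n\<in>S. (u n)\<^sup>2) \<le> real (card S) * (2 * ln (8 * K) + 5 / 2)"
proof -
  have ln1: "1 \<le> ln (8 * K)"
  proof -
    have "exp 1 \<le> 8 * K" using exp_le assms(2) by linarith
    then show ?thesis using assms(2) by (simp add: ln_ge_iff)
  qed
  \<comment> \<open>Chosen so that \<open>exp (\<tau>\<^sup>2 / 2) = 8 * K\<close>. The exponential
    terms then add 20 K / (8K) = 5/2 per element of \<open>S\<close>.\<close>
  define \<tau> where "\<tau> = sqrt (2 * ln (8 * K))"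
  have sq: "\<tau>\<^sup>2 = 2 * ln (8 * K)" using ln1 by (simp add: \<tau>_def)
  have "\<tau> \<ge> 1" using ln1 by (simp add: \<tau>_def)
  have exp_half: "exp (\<tau>\<^sup>2 / 2) = 8 * K" using assms(2) by (simp add: sq)
  have exp_sq: "exp (- \<tau>\<^sup>2) = 1 / (8 * K)\<^sup>2"
  proof -
    have "exp (\<tau>\<^sup>2) = (8 * K)\<^sup>2"
      using exp_double[of "\<tau>\<^sup>2 / 2"] by (simp only: exp_half) simp
    then show ?thesis by (simp only: exp_minus inverse_eq_divide)
  qed
  have "(\<Sum>n\<in>S. (u n)\<^sup>2) \<le> (\<Sum>n\<in>S. \<tau>\<^sup>2 + 2 * exp (- \<tau>\<^sup>2) * (exp (\<tau> * u n) + exp (- \<tau> * u n)))"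
  proof (rule sum_mono)
    fix n
    have "(u n)\<^sup>2 \<le> \<tau>\<^sup>2 + 2 * exp (- \<tau>\<^sup>2) * exp (\<tau> * \<bar>u n\<bar>)"
      using square_le_exp[OF \<open>\<tau> \<ge> 1\<close>, of "u n"] by (simp add: exp_diff exp_minus divide_inverse mult_ac)
    \<comment> \<open>Removes the absolute value; the moment hypothesis covers both signs of
      \<open>\<tau>\<close>.\<close>
    also have "exp (\<tau> * \<bar>u n\<bar>) \<le> exp (\<tau> * u n) + exp (- \<tau> * u n)"
      by (cases "u n \<ge> 0") (auto intro: less_imp_le)
    finally show "(u n)\<^sup>2 \<le> \<tau>\<^sup>2 + 2 * exp (- \<tau>\<^sup>2) * (exp (\<tau> * u n) + exp (- \<tau> * u n))"
      by simp
  qed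
  also have "\<dots> = real (card S) * \<tau>\<^sup>2
      + 2 * exp (- \<tau>\<^sup>2) * ((\<Sum>n\<in>S. exp (\<tau> * u n)) + (\<Sum>n\<in>S. exp (- \<tau> * u n)))"
    by (simp add: sum.distrib sum_distrib_left distrib_left)
  also have "\<dots> \<le> real (card S) * \<tau>\<^sup>2 + 2 * exp (- \<tau>\<^sup>2) *
      (5 * K * real (card S) * exp (\<tau>\<^sup>2 / 2) + 5 * K * real (card S) * exp ((- \<tau>)\<^sup>2 / 2))"
    by (intro add_left_mono mult_left_mono add_mono assms(3)) auto
  also have "\<dots> = real (card S) * \<tau>\<^sup>2 + 20 * real (card S) * (exp (- \<tau>\<^sup>2) * K * exp (\<tau>\<^sup>2 / 2))"
    by (simp add: mult_ac)
  also have "exp (- \<tau>\<^sup>2) * K * exp (\<tau>\<^sup>2 / 2) = 1 / 8"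
    unfolding exp_half exp_sq using assms(2) by (simp add: power2_eq_square)
  also have "real (card S) * \<tau>\<^sup>2 + 20 * real (card S) * (1 / 8) = real (card S) * (2 * ln (8 * K) + 5 / 2)"
    unfolding sq by (simp add: distrib_left)
  finally show ?thesis .
qed

lemma sum_norm_square_dual_le:
  fixes X :: "circle set" and a :: "circle \<Rightarrow> complex"
  assumes "finite X" "d > 0" "N \<ge> 1"
    and spaced: "\<And>A B. A \<subseteq> X \<Longrightarrow> B \<subseteq> X \<Longrightarrow> A \<noteq> B \<Longrightarrow> d \<le> circle_norm (\<Sum>A - \<Sum>B)"
    and S: "S \<subseteq> {1..N}" "S \<noteq> {}"
  shows "(\<Sum>n\<in>S. (cmod (\<Sum>x\<in>X. a x * circle_exp x ^ n))\<^sup>2)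
           \<le> 9 * real (card S) * ln (8 * (real N + 1 / d) / real (card S)) * (\<Sum>x\<in>X. (cmod (a x))\<^sup>2)"
proof -
  define \<sigma> where "\<sigma> = (\<Sum>x\<in>X. (cmod (a x))\<^sup>2)"
  define G where "G n = (\<Sum>x\<in>X. a x * circle_exp x ^ n)" for n
  define K where "K = (real N + 1 / d) / real (card S)"
  have fin: "finite S" using S finite_subset by blast
  have cardS: "card S > 0" "card S \<le> N"
    using S fin card_mono[OF _ S(1)] by (auto simp: card_gt_0_iff)
  have "real (card S) \<le> real N + 1 / d"
    using cardS(2) assms(2) by (intro add_increasing2) auto
  then have K: "K \<ge> 1" "K * real (card S) = real N + 1 / d"
    using cardS(1) by (auto simp: K_def)
  have "\<sigma> \<ge> 0" by (simp add: \<sigma>_def sum_nonneg)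
  show ?thesis
  proof (cases "\<sigma> = 0")
    case True
    then have "\<forall>x\<in>X. a x = 0"
      using assms(1) by (simp add: \<sigma>_def sum_nonneg_eq_0_iff)
    then show ?thesis by simp
  next
    case False
    with \<open>\<sigma> \<ge> 0\<close> have \<sigma>: "\<sigma> > 0" by simp
    \<comment> \<open>A complex multiplier \<open>z\<close> provides at once the scaling by
      \<open>\<tau>\<close>, the normalisation by \<open>sqrt \<sigma>\<close> and the rotation that
      selects the real or imaginary part.\<close>
    have moment: "(\<Sum>n\<in>S. exp (Re (z * G n))) \<le> 5 * K * real (card S) * exp ((cmod z)\<^sup>2 * \<sigma> / 2)" for z
    proof -
      have "(\<Sum>n\<in>S. exp (Re (z * G n))) \<le> (\<Sum>n=1..N. exp (Re (z * G n)))"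
        using S by (intro sum_mono2) auto
      also have "\<dots> = (\<Sum>n=1..N. exp (Re (\<Sum>x\<in>X. z * a x * circle_exp x ^ n)))"
        by (simp add: G_def sum_distrib_left mult.assoc)
      also have "\<dots> \<le> 5 * (real N + 1 / d) * exp ((\<Sum>x\<in>X. (cmod (z * a x))\<^sup>2) / 2)"
        by (rule sum_exp_Re_le) (use assms in auto)
      also have "(\<Sum>x\<in>X. (cmod (z * a x))\<^sup>2) = (cmod z)\<^sup>2 * \<sigma>"
        by (simp add: \<sigma>_def norm_mult power_mult_distrib sum_distrib_left)
      finally show ?thesis using K(2) by (simp add: mult.assoc)
    qed
    have part: "(\<Sum>n\<in>S. (Re (\<eta> * G n) / sqrt \<sigma>)\<^sup>2) \<le> real (card S) * (2 * ln (8 * K) + 5 / 2)"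
      if "cmod \<eta> = 1" for \<eta>
    proof (rule sum_square_le_of_sum_exp_le[OF fin K(1)])
      fix \<tau> :: real
      show "(\<Sum>n\<in>S. exp (\<tau> * (Re (\<eta> * G n) / sqrt \<sigma>))) \<le> 5 * K * real (card S) * exp (\<tau>\<^sup>2 / 2)"
        using moment[of "of_real (\<tau> / sqrt \<sigma>) * \<eta>"] \<sigma> that
        by (simp add: norm_mult norm_divide power_divide mult.assoc)
    qed
    have "exp 1 \<le> 8 * K" using exp_le K(1) by linarith
    then have ln1: "1 \<le> ln (8 * K)" using K(1) by (simp add: ln_ge_iff)
    \<comment> \<open>The imaginary part of \<open>G n\<close> is the real part of
      \<open>- \<i> * G n\<close>.\<close>
    have "(\<Sum>n\<in>S. (cmod (G n))\<^sup>2) / \<sigma>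
        = (\<Sum>n\<in>S. (Re (1 * G n) / sqrt \<sigma>)\<^sup>2) + (\<Sum>n\<in>S. (Re (- \<i> * G n) / sqrt \<sigma>)\<^sup>2)"
      using \<sigma> by (simp add: cmod_power2 power_divide sum_divide_distrib sum.distrib add_divide_distrib)
    also have "\<dots> \<le> real (card S) * (2 * ln (8 * K) + 5 / 2) + real (card S) * (2 * ln (8 * K) + 5 / 2)"
      by (intro add_mono part) auto
    also have "\<dots> = real (card S) * (4 * ln (8 * K) + 5)" by (simp add: algebra_simps)
    \<comment> \<open>The constant 9 is 4 + 5, absorbing 5 through
      \<open>1 \<le> ln (8 * K)\<close>.\<close>
    also have "\<dots> \<le> real (card S) * (9 * ln (8 * K))"
      using ln1 by (intro mult_left_mono) auto
    finally show ?thesis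
      using \<sigma> by (simp add: G_def \<sigma>_def[symmetric] K_def field_simps)
  qed
qed

section \<open>Duality and conclusion\<close>

lemma delta_star_spacing:
  assumes "finite X" "X \<noteq> {}" "delta_star X > 0"
  obtains d where "d > 0" "delta_star X = ereal d"
    "\<And>A B. A \<subseteq> X \<Longrightarrow> B \<subseteq> X \<Longrightarrow> A \<noteq> B \<Longrightarrow> d \<le> circle_norm (\<Sum>A - \<Sum>B)"
proof -
  obtain d where d: "delta_star X = ereal d"
    using delta_star_eq_Min[OF assms(1,2)] by blast
  have "d \<le> circle_norm (\<Sum>A - \<Sum>B)" if "A \<subseteq> X" "B \<subseteq> X" "A \<noteq> B" for A B
  proof -
    have "delta_star X \<le> ereal (circle_norm (\<Sum>A - \<Sum>B))"
      unfolding delta_star_def by (rule Inf_lower) (use that in blast)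
    then show ?thesis by (simp add: d)
  qed
  with that[of d] d assms(3) show ?thesis by simp
qed

lemma l2_norm_square:
  assumes "finite S" "\<And>n. n \<notin> S \<Longrightarrow> f n = 0"
  shows "(l2_norm f)\<^sup>2 = (\<Sum>n\<in>S. (cmod (f n))\<^sup>2)"
proof -
  have "(\<Sum>\<^sub>\<infinity>n. (cmod (f n))\<^sup>2) = (\<Sum>\<^sub>\<infinity>n\<in>S. (cmod (f n))\<^sup>2)"
    by (rule infsum_cong_neutral) (use assms in auto)
  then show ?thesis using assms(1) by (simp add: l2_norm_def sum_nonneg)
qed

lemma exp_sum_power_sum_le:
  fixes X :: "circle set"
  assumes "N \<ge> 1" "finite X" "delta_star X > 0" "S \<subseteq> {1..N}" "S \<noteq> {}"
    and f: "\<And>n. n \<notin> S \<Longrightarrow> f n = 0" and l: "l \<ge> 1"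
  shows "(\<Sum>x\<in>X. cmod (exp_sum N f x) powr (l + 1))\<^sup>2
           \<le> 9 * real (card S) * (l2_norm f)\<^sup>2
              * (\<Sum>x\<in>X. cmod (exp_sum N f x) powr (2 * l))
              * ln (8 * (real N + real_of_ereal (inverse (delta_star X))) / real (card S))"
proof (cases "X = {}")
  case False
  obtain d where d: "d > 0" "delta_star X = ereal d"
    "\<And>A B. A \<subseteq> X \<Longrightarrow> B \<subseteq> X \<Longrightarrow> A \<noteq> B \<Longrightarrow> d \<le> circle_norm (\<Sum>A - \<Sum>B)"
    using delta_star_spacing[OF assms(2) False assms(3)] by blast
  have inv: "real_of_ereal (inverse (delta_star X)) = 1 / d"
    using d(1,2) by (simp add: divide_inverse)
  have fin: "finite S" using assms(4) finite_subset by blast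
  define W where "W = exp_sum N f"
  have W: "W x = (\<Sum>n\<in>S. f n * circle_exp x ^ n)" for x
    unfolding W_def exp_sum_def circle_exp_scale
    by (rule sum.mono_neutral_right) (use assms in auto)
  \<comment> \<open>Dual weights: the phase turns \<open>a x * W x\<close> into
    \<open>cmod (W x) powr (l + 1)\<close>, while the squared moduli give the sum with exponent
    \<open>2 * l\<close>.\<close>
  define a where "a x = of_real (cmod (W x) powr l) * cnj (sgn (W x))" for x
  define G where "G n = (\<Sum>x\<in>X. a x * circle_exp x ^ n)" for n
  have aW: "a x * W x = of_real (cmod (W x) powr (l + 1))" for x
  proof -
    have "cnj (sgn (W x)) * W x = of_real (cmod (W x))"
      by (cases "W x = 0") (auto simp: sgn_eq complex_norm_square[symmetric] power2_eq_square mult.commute)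
    then show ?thesis by (simp add: a_def powr_add mult.assoc)
  qed
  have a_sq: "(cmod (a x))\<^sup>2 = cmod (W x) powr (2 * l)" for x
    by (simp add: a_def norm_mult norm_sgn powr_powr mult.commute flip: powr_numeral)
  have "of_real (\<Sum>x\<in>X. cmod (W x) powr (l + 1)) = (\<Sum>x\<in>X. a x * W x)"
    by (simp add: aW)
  \<comment> \<open>Exchanging the sums moves the weights onto \<open>G\<close>, so that
    Cauchy-Schwarz separates \<open>f\<close> from the dual mean square.\<close>
  also have "\<dots> = (\<Sum>n\<in>S. f n * G n)"
    unfolding W G_def sum_distrib_left by (subst sum.swap) (simp add: mult_ac)
  finally have dual: "complex_of_real (\<Sum>x\<in>X. cmod (W x) powr (l + 1)) = \<dots>" .
  have "(\<Sum>x\<in>X. cmod (W x) powr (l + 1)) = cmod (complex_of_real (\<Sum>x\<in>X. cmod (W x) powr (l + 1)))"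
    by (simp only: norm_of_real) (simp add: sum_nonneg)
  also have "\<dots> \<le> (\<Sum>n\<in>S. cmod (f n) * cmod (G n))"
    unfolding dual by (rule order.trans[OF norm_sum]) (simp add: norm_mult)
  finally have "(\<Sum>x\<in>X. cmod (W x) powr (l + 1))\<^sup>2 \<le> (\<Sum>n\<in>S. cmod (f n) * cmod (G n))\<^sup>2"
    by (intro power_mono) (auto simp: sum_nonneg)
  also have "\<dots> \<le> (\<Sum>n\<in>S. (cmod (f n))\<^sup>2) * (\<Sum>n\<in>S. (cmod (G n))\<^sup>2)"
    by (rule Cauchy_Schwarz_ineq_sum)
  also have "\<dots> \<le> (\<Sum>n\<in>S. (cmod (f n))\<^sup>2) * (9 * real (card S)
      * ln (8 * (real N + 1 / d) / real (card S)) * (\<Sum>x\<in>X. (cmod (a x))\<^sup>2))"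
    unfolding G_def by (intro mult_left_mono sum_norm_square_dual_le sum_nonneg) (use assms d in auto)
  also have "(\<Sum>n\<in>S. (cmod (f n))\<^sup>2) = (l2_norm f)\<^sup>2"
    using l2_norm_square[OF fin, of f] f by simp
  finally show ?thesis
    by (simp only: W_def[symmetric] a_sq inv mult_ac)
qed simp

theorem theorem1p1:
  fixes N :: nat and X :: "circle set" and S :: "nat set" and f :: "nat \<Rightarrow> complex"
  assumes "N \<ge> 1"
    and "finite X"
    and "delta_star X > 0"
    and "S \<subseteq> {1..N}"
    and "S \<noteq> {}"
    and "\<And>n. n \<notin> S \<Longrightarrow> f n = 0"
  shows "(\<Sum>x\<in>X. (cmod (exp_sum N f x))\<^sup>2)
           \<le> 9 * real (card S) * (l2_norm f)\<^sup>2
              * ln (8 * (real N + real_of_ereal (inverse (delta_star X))) / real (card S))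
       \<and> (\<forall>l::real. l \<ge> 1 \<longrightarrow>
           (\<Sum>x\<in>X. cmod (exp_sum N f x) powr (l + 1))\<^sup>2
             \<le> 9 * real (card S) * (l2_norm f)\<^sup>2
                * (\<Sum>x\<in>X. cmod (exp_sum N f x) powr (2 * l))
                * ln (8 * (real N + real_of_ereal (inverse (delta_star X))) / real (card S)))"
proof (intro conjI allI impI)
  note main = exp_sum_power_sum_le[OF assms(1-5), where f = f, OF assms(6)]
  define T where "T = (\<Sum>x\<in>X. (cmod (exp_sum N f x))\<^sup>2)"
  define r where "r = real_of_ereal (inverse (delta_star X))"
  define L where "L = ln (8 * (real N + r) / real (card S))"
  have "card S > 0" "card S \<le> N"
    using assms(4,5) card_mono[OF _ assms(4)] finite_subset[OF assms(4)] by (auto simp: card_gt_0_iff)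
  moreover have "r \<ge> 0"
    unfolding r_def using assms(3) by (intro real_of_ereal_pos) (simp add: ereal_inverse_nonneg_iff)
  ultimately have "L \<ge> 0"
    unfolding L_def by (intro ln_ge_zero) (simp add: field_simps)
  \<comment> \<open>For \<open>l = 1\<close> both exponents are 2, so \<open>T\<close> occurs on
    both sides and one factor cancels. If \<open>T = 0\<close>, the claim rests on
    \<open>L \<ge> 0\<close>, which comes from \<open>card S \<le> N\<close>.\<close>
  have "T\<^sup>2 \<le> 9 * real (card S) * (l2_norm f)\<^sup>2 * T * L"
    using main[of 1] by (simp add: T_def L_def r_def)
  then have *: "T * T \<le> T * (9 * real (card S) * (l2_norm f)\<^sup>2 * L)"
    by (simp add: power2_eq_square mult_ac)
  have "T \<ge> 0" by (simp add: T_def sum_nonneg)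
  have "T \<le> 9 * real (card S) * (l2_norm f)\<^sup>2 * L"
  proof (cases "T = 0")
    case False
    with * \<open>T \<ge> 0\<close> show ?thesis by simp
  qed (use \<open>L \<ge> 0\<close> in simp)
  then show "(\<Sum>x\<in>X. (cmod (exp_sum N f x))\<^sup>2) \<le> 9 * real (card S) * (l2_norm f)\<^sup>2
      * ln (8 * (real N + real_of_ereal (inverse (delta_star X))) / real (card S))"
    by (simp only: T_def L_def r_def)
qed (rule exp_sum_power_sum_le[OF assms(1-5), where f = f, OF assms(6)])

end
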